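(* Let $n\ge 3$. Every saturated convex $\Theta^2$-drawing of a graph $G$ on $n$ vertices contains exactly $3n-6$ edges. Likewise, every saturated precolored convex $\Theta^2$-drawing of a graph $G$ on $n$ vertices contains exactly $3n-6$ edges.
   Context: Graphs are finite and simple. In a straight-line drawing, vertices are distinct points of the plane in general position (no three on a line) and edges are straight-line segments; two edges cross if their relative interiors share a point. A $\Theta^2$-drawing of a graph $G$ is a straight-line drawing $\Gamma$ of $G$ for which there exists an edge-coloring $\varphi\colon E(G)\to\{1,2\}$ such that no two edges of the same color cross. A precolored $\Theta^2$-drawing is a $\Theta^2$-drawing together with a fixed such coloring $\varphi$. The drawing is convex if its vertices are in convex position. A (non-precolored) $\Theta^2$-drawing $\Gamma$ of $G$ is saturated if there are no two distinct vertices $u,v$ with $uv\notin E(G)$ such that $\Gamma$ together with the straight-line edge $uv$ is also a $\Theta^2$-drawing (for some coloring, possibly recoloring all edges). A precolored $\Theta^2$-drawing $\Gamma$ with coloring $\varphi$ is saturated if there are no two distinct vertices $u,v$ with $uv\notin E(G)$ and no color $i\in\{1,2\}$ such that adding the straight-line edge $uv$ with color $i$ to $\Gamma$ (keeping the colors of all other edges) yields a drawing without monochromatic crossings. *)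

theory Defs
  imports "HOL-Analysis.Analysis"
begin

definition simple_graph :: "'a set \<Rightarrow> 'a set set \<Rightarrow> bool" where
  "simple_graph V E \<longleftrightarrow> finite V \<and> (\<forall>e\<in>E. e \<subseteq> V \<and> card e = 2)"

definition general_position :: "(real^2) set \<Rightarrow> bool" where
  "general_position S \<longleftrightarrow>
     (\<forall>a\<in>S. \<forall>b\<in>S. \<forall>c\<in>S. a \<noteq> b \<and> b \<noteq> c \<and> a \<noteq> c \<longrightarrow> \<not> collinear {a, b, c})"

definition convex_position :: "(real^2) set \<Rightarrow> bool" where
  "convex_position S \<longleftrightarrow> (\<forall>x\<in>S. x \<notin> convex hull (S - {x}))"

text \<open>
  A straight-line drawing of the graph \<open>(V, E)\<close> is determined by the positions \<open>p\<close> of its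
  vertices; the edge \<open>{u, v}\<close> is drawn as the segment \<open>convex hull {p u, p v}\<close>.
\<close>

definition straight_line_drawing :: "'a set \<Rightarrow> 'a set set \<Rightarrow> ('a \<Rightarrow> real^2) \<Rightarrow> bool" where
  "straight_line_drawing V E p \<longleftrightarrow>
     simple_graph V E \<and> inj_on p V \<and> general_position (p ` V)"

definition edge_segment :: "('a \<Rightarrow> real^2) \<Rightarrow> 'a set \<Rightarrow> (real^2) set" where
  "edge_segment p e = convex hull (p ` e)"

definition crosses :: "('a \<Rightarrow> real^2) \<Rightarrow> 'a set \<Rightarrow> 'a set \<Rightarrow> bool" where
  "crosses p e f \<longleftrightarrow>
     e \<noteq> f \<and> rel_interior (edge_segment p e) \<inter> rel_interior (edge_segment p f) \<noteq> {}"

definition precolored_theta2_drawing ::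
    "'a set \<Rightarrow> 'a set set \<Rightarrow> ('a \<Rightarrow> real^2) \<Rightarrow> ('a set \<Rightarrow> nat) \<Rightarrow> bool" where
  "precolored_theta2_drawing V E p \<phi> \<longleftrightarrow>
     straight_line_drawing V E p \<and> \<phi> ` E \<subseteq> {1, 2} \<and>
     (\<forall>e\<in>E. \<forall>f\<in>E. \<phi> e = \<phi> f \<longrightarrow> \<not> crosses p e f)"

definition theta2_drawing :: "'a set \<Rightarrow> 'a set set \<Rightarrow> ('a \<Rightarrow> real^2) \<Rightarrow> bool" where
  "theta2_drawing V E p \<longleftrightarrow> (\<exists>\<phi>. precolored_theta2_drawing V E p \<phi>)"

definition saturated_theta2_drawing :: "'a set \<Rightarrow> 'a set set \<Rightarrow> ('a \<Rightarrow> real^2) \<Rightarrow> bool" where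
  "saturated_theta2_drawing V E p \<longleftrightarrow>
     theta2_drawing V E p \<and>
     \<not> (\<exists>u\<in>V. \<exists>v\<in>V. u \<noteq> v \<and> {u, v} \<notin> E \<and> theta2_drawing V (insert {u, v} E) p)"

definition saturated_precolored_theta2_drawing ::
    "'a set \<Rightarrow> 'a set set \<Rightarrow> ('a \<Rightarrow> real^2) \<Rightarrow> ('a set \<Rightarrow> nat) \<Rightarrow> bool" where
  "saturated_precolored_theta2_drawing V E p \<phi> \<longleftrightarrow>
     precolored_theta2_drawing V E p \<phi> \<and>
     \<not> (\<exists>u\<in>V. \<exists>v\<in>V. \<exists>i\<in>{1, 2}. u \<noteq> v \<and> {u, v} \<notin> E \<and>
          precolored_theta2_drawing V (insert {u, v} E) p (\<phi>({u, v} := i)))"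

end

theory Submission
  imports Defs
begin

text \<open>
  Label the vertices \<open>0, \<dots>, n - 1\<close> along the convex polygon, so that crossing of edges becomes
  interleaving of index pairs. Sides of the polygon cross nothing, hence all of them are edges. Add
  the sides to one color class. If the result were not a triangulation, it would have an inner
  face with at least four corners; by saturation every diagonal of that face is an edge of the
  other color, but two of these diagonals cross. So both color classes together with the sides
  are triangulations with \<open>2n - 3\<close> edges that share exactly the \<open>n\<close> sides, and
  \<open>2(2n - 3) - n = 3n - 6\<close>.
\<close>

section \<open>Triangulations of an interval of indices\<close>

text \<open>Models the crossing of two chords of a convex polygon. Pairs are meant to be increasing,
  and the inequalities are strict because chords with a common endpoint do not cross.\<close>

fun interleave :: "nat \<times> nat \<Rightarrow> nat \<times> nat \<Rightarrow> bool" where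
  "interleave (a, b) (c, d) \<longleftrightarrow> a < c \<and> c < b \<and> b < d \<or> c < a \<and> a < d \<and> d < b"

lemma interleave_commute: "interleave s t \<longleftrightarrow> interleave t s"
  by (cases s; cases t) auto

lemma not_interleave_refl: "\<not> interleave s s"
  by (cases s) auto

text \<open>
  The last hypothesis says that no inner face has four or more corners: inside such a face there
  would be two interleaving chords that do not interleave with anything in \<open>S\<close>.
\<close>

lemma card_triangulated_interval:
  fixes a b :: nat and S :: "(nat \<times> nat) set"
  assumes "a < b"
    and "S \<subseteq> {(x, y). a \<le> x \<and> x < y \<and> y \<le> b}"
    and "\<forall>s\<in>S. \<forall>t\<in>S. \<not> interleave s t"
    and "(a, b) \<in> S"
    and "\<forall>i. a \<le> i \<and> i < b \<longrightarrow> (i, Suc i) \<in> S"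
    and "\<And>x x' y y'. a \<le> x \<Longrightarrow> x < x' \<Longrightarrow> x' < y \<Longrightarrow> y < y' \<Longrightarrow> y' \<le> b \<Longrightarrow>
           \<exists>s\<in>S. interleave (x, y) s \<or> interleave (x', y') s"
  shows "card S = 2 * (b - a) - 1"
  using assms
proof (induction "b - a" arbitrary: a b S rule: less_induct)
  case less
  note sub = less.prems(2) and nc = less.prems(3) and ab = less.prems(4)
    and sides = less.prems(5) and full = less.prems(6)
  have subD: "a \<le> x \<and> x < y \<and> y \<le> b" if "(x, y) \<in> S" for x y
    using that sub by auto
  have ncD: "\<not> (x < x' \<and> x' < y \<and> y < y')" if "(x, y) \<in> S" "(x', y') \<in> S" for x y x' y'
    using nc that by fastforce
  show ?case
  proof (cases "b = Suc a")
    case True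
    have "S = {(a, b)}"
      using ab True subD by (auto; fastforce)
    then show ?thesis using True by simp
  next
    case False
    \<comment> \<open>The triangle of the triangulation on the base \<open>(a, b)\<close> has as
      apex the largest neighbour \<open>c\<close> of \<open>a\<close> below \<open>b\<close>; the
      side at \<open>a\<close> ensures that a candidate exists.\<close>
    define C where "C = {c. c < b \<and> (a, c) \<in> S}"
    have "finite C" unfolding C_def by simp
    have "Suc a \<in> C" unfolding C_def using sides False \<open>a < b\<close> by auto
    define c where "c = Max C"
    have cC: "c \<in> C" unfolding c_def using \<open>finite C\<close> \<open>Suc a \<in> C\<close> Max_in by blast
    have cmax: "y \<le> c" if "(a, y) \<in> S" "y < b" for y
      unfolding c_def using that \<open>finite C\<close> by (intro Max_ge) (auto simp: C_def)
    have ac: "(a, c) \<in> S" "c < b" "a < c" using cC subD by (auto simp: C_def)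
    \<comment> \<open>If \<open>(c, b)\<close> were missing, the largest neighbour \<open>e\<close>
      of \<open>c\<close> would lie below \<open>b\<close>, and \<open>a\<close>, \<open>c\<close>,
      \<open>e\<close>, \<open>b\<close> would be corners of one face. The face hypothesis for its
      diagonals \<open>(a, e)\<close> and \<open>(c, b)\<close> then gives a chord
      \<open>(x, y)\<close> of \<open>S\<close> that enters this face.\<close>
    have cb: "(c, b) \<in> S"
    proof (rule ccontr)
      assume ncb: "(c, b) \<notin> S"
      define D where "D = {e. (c, e) \<in> S}"
      have "D \<subseteq> {..b}" unfolding D_def using subD by auto
      then have "finite D" using finite_subset by blast
      have "Suc c \<in> D" unfolding D_def using sides ac by auto
      define e where "e = Max D"
      have eD: "e \<in> D" unfolding e_def using \<open>finite D\<close> \<open>Suc c \<in> D\<close> Max_in by blast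
      have emax: "y \<le> e" if "(c, y) \<in> S" for y
        unfolding e_def using that \<open>finite D\<close> by (intro Max_ge) (auto simp: D_def)
      have ce: "(c, e) \<in> S" "c < e" "e < b"
        using eD subD ncb by (auto simp: D_def order_less_le)
      obtain x y where xy: "(x, y) \<in> S" "interleave (a, e) (x, y) \<or> interleave (c, b) (x, y)"
        using full[of a c e b] ac ce by auto
      \<comment> \<open>The other two interleaving patterns leave the interval. Each remaining chord
        crosses \<open>(a, c)\<close> or \<open>(c, e)\<close>, or contradicts the maximality of
        \<open>e\<close> (if it starts at \<open>c\<close>) or of \<open>c\<close> (if it starts at
        \<open>a\<close>).\<close>
      then consider "a < x" "x < e" "e < y" | "x < c" "c < y" "y < b"
        using subD[OF xy(1)] by auto
      then show False
      proof cases
        case 1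
        then show False
          using ncD[OF ac(1) xy(1)] ncD[OF ce(1) xy(1)] emax[of y] xy(1) ce
          by (metis less_trans linorder_neqE_nat not_le)
      next
        case 2
        then show False
          using ncD[OF ac(1) xy(1)] cmax[of y] xy(1) subD[OF xy(1)]
          by (metis le_neq_implies_less not_le)
      qed
    qed
    define L where "L = {(x, y) \<in> S. y \<le> c}"
    define R where "R = {(x, y) \<in> S. c \<le> x}"
    have subLS: "L \<subseteq> S" "R \<subseteq> S" by (auto simp: L_def R_def)
    have LI: "(x, y) \<in> L \<longleftrightarrow> (x, y) \<in> S \<and> y \<le> c" for x y by (auto simp: L_def)
    have RI: "(x, y) \<in> R \<longleftrightarrow> (x, y) \<in> S \<and> c \<le> x" for x y by (auto simp: R_def)
    \<comment> \<open>A chord passing over \<open>c\<close> crosses \<open>(a, c)\<close> unless it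
      starts at \<open>a\<close>, and crosses \<open>(c, b)\<close> unless it ends at
      \<open>b\<close>.\<close>
    have split: "(x, y) = (a, b) \<or> (x, y) \<in> L \<or> (x, y) \<in> R" if "(x, y) \<in> S" for x y
      using ncD[OF ac(1) that] ncD[OF that cb] subD[OF that] that ac
      by (auto simp: LI RI)
    have cardL: "card L = 2 * (c - a) - 1"
    proof (rule less.hyps)
      show "L \<subseteq> {(x, y). a \<le> x \<and> x < y \<and> y \<le> c}" by (auto simp: LI dest: subD)
      show "\<forall>s\<in>L. \<forall>t\<in>L. \<not> interleave s t" using nc subLS by blast
      show "\<forall>i. a \<le> i \<and> i < c \<longrightarrow> (i, Suc i) \<in> L" using sides ac by (auto simp: LI)
      fix x x' y y' assume h: "a \<le> x" "x < x'" "x' < y" "y < y'" "y' \<le> c"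
      then obtain u v where uv: "(u, v) \<in> S" "interleave (x, y) (u, v) \<or> interleave (x', y') (u, v)"
        using full[of x x' y y'] ac by auto
      \<comment> \<open>The face hypothesis restricts to \<open>L\<close>: neither
        \<open>(a, b)\<close> nor a chord starting at or beyond \<open>c\<close> can interleave with
        a chord inside the interval from \<open>a\<close> to \<open>c\<close>.\<close>
      then have "(u, v) \<in> L"
        using split[OF uv(1)] h ac by (auto simp: RI dest: subD)
      then show "\<exists>s\<in>L. interleave (x, y) s \<or> interleave (x', y') s" using uv by blast
    qed (use ac in \<open>auto simp: LI\<close>)
    have cardR: "card R = 2 * (b - c) - 1"
    proof (rule less.hyps)
      show "R \<subseteq> {(x, y). c \<le> x \<and> x < y \<and> y \<le> b}" by (auto simp: RI dest: subD)
      show "\<forall>s\<in>R. \<forall>t\<in>R. \<not> interleave s t" using nc subLS by blast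
      show "\<forall>i. c \<le> i \<and> i < b \<longrightarrow> (i, Suc i) \<in> R" using sides ac by (auto simp: RI)
      fix x x' y y' assume h: "c \<le> x" "x < x'" "x' < y" "y < y'" "y' \<le> b"
      then obtain u v where uv: "(u, v) \<in> S" "interleave (x, y) (u, v) \<or> interleave (x', y') (u, v)"
        using full[of x x' y y'] ac by auto
      then have "(u, v) \<in> R"
        using split[OF uv(1)] h ac by (auto simp: LI dest: subD)
      then show "\<exists>s\<in>R. interleave (x, y) s \<or> interleave (x', y') s" using uv by blast
    qed (use ac cb in \<open>auto simp: RI\<close>)
    have "S \<subseteq> {..b} \<times> {..b}" by (auto dest: subD)
    then have "finite S" using finite_subset by blast
    then have fin: "finite L" "finite R" using subLS finite_subset by blast+
    have S_eq: "S = insert (a, b) (L \<union> R)"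
    proof
      show "S \<subseteq> insert (a, b) (L \<union> R)" using split by (intro subrelI) blast
      show "insert (a, b) (L \<union> R) \<subseteq> S" using ab subLS by blast
    qed
    have "(a, b) \<notin> L \<union> R" using ac by (simp add: LI RI)
    moreover have "L \<inter> R = {}"
    proof -
      have False if "(x, y) \<in> L" "(x, y) \<in> R" for x y
        using that subD[of x y] by (simp add: LI RI)
      then show ?thesis by auto
    qed
    ultimately have "card S = Suc (card L + card R)"
      unfolding S_eq using fin by (simp add: card_Un_disjoint)
    then show ?thesis using cardL cardR ac by linarith
  qed
qed

section \<open>Orientation and the cyclic order of points in convex position\<close>

text \<open>Twice the signed area of the triangle \<open>a\<close>, \<open>b\<close>,
  \<open>c\<close>; positive exactly when the triple turns counterclockwise.\<close>

definition orient :: "real^2 \<Rightarrow> real^2 \<Rightarrow> real^2 \<Rightarrow> real" where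
  "orient a b c = (b $ 1 - a $ 1) * (c $ 2 - a $ 2) - (b $ 2 - a $ 2) * (c $ 1 - a $ 1)"

lemma orient_rotate: "orient a b c = orient b c a"
  by (simp add: orient_def algebra_simps)

lemma orient_swap: "orient a c b = - orient a b c"
  by (simp add: orient_def algebra_simps)

lemma orient_degenerate [simp]: "orient a a b = 0" "orient a b a = 0" "orient a b b = 0"
  by (simp_all add: orient_def)

lemma orient_affine:
  "orient a b ((1 - t) *\<^sub>R c + t *\<^sub>R d) = (1 - t) * orient a b c + t * orient a b d"
  by (simp add: orient_def algebra_simps)

text \<open>Turns general position into nonvanishing of \<open>orient\<close>. A zero determinant
  makes \<open>c - a\<close> a multiple of \<open>b - a\<close>, the factor being a quotient of
  coordinates where \<open>b - a\<close> does not vanish.\<close>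

lemma orient_eq_0_imp_collinear:
  assumes "orient a b c = 0"
  shows "collinear {a, b, c}"
proof (cases "a = b")
  case False
  then have nz: "b $ 1 - a $ 1 \<noteq> 0 \<or> b $ 2 - a $ 2 \<noteq> 0"
    by (auto simp: vec_eq_iff forall_2)
  have eq: "(b $ 1 - a $ 1) * (c $ 2 - a $ 2) = (b $ 2 - a $ 2) * (c $ 1 - a $ 1)"
    using assms by (simp add: orient_def)
  have scale: "y' = (x' / x) * y" if "x \<noteq> 0" "x * y' = y * x'" for x y x' y' :: real
    using that by (simp add: field_simps)
  have "\<exists>k. c - a = k *\<^sub>R (b - a)"
  proof (cases "b $ 1 - a $ 1 = 0")
    case True
    then show ?thesis using nz eq
      by (intro exI[of _ "(c $ 2 - a $ 2) / (b $ 2 - a $ 2)"])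
         (auto simp: vec_eq_iff forall_2)
  next
    case False
    then show ?thesis using scale[OF False eq]
      by (intro exI[of _ "(c $ 1 - a $ 1) / (b $ 1 - a $ 1)"])
         (auto simp: vec_eq_iff forall_2)
  qed
  then have "collinear {0, b - a, c - a}" by (auto simp: collinear_lemma)
  then show ?thesis using collinear_3[of b a c] by (simp add: insert_commute)
qed (simp add: collinear_2)

text \<open>The barycentric coordinates of \<open>d\<close> are the signed areas of the three
  triangles obtained by replacing one corner with \<open>d\<close>, divided by the total
  area.\<close>

lemma in_triangleI:
  assumes "orient a b c > 0" "orient d b c \<ge> 0" "orient a d c \<ge> 0" "orient a b d \<ge> 0"
  shows "d \<in> convex hull {a, b, c}"
proof -
  let ?D = "orient a b c"
  define u v w where "u = orient d b c / ?D" and "v = orient a d c / ?D" and "w = orient a b d / ?D"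
  have "orient d b c + orient a d c + orient a b d = ?D"
    by (simp add: orient_def algebra_simps)
  then have sum: "u + v + w = 1"
    using assms(1) by (simp add: u_def v_def w_def flip: add_divide_distrib)
  have "?D * d $ i = orient d b c * a $ i + orient a d c * b $ i + orient a b d * c $ i" for i
    using exhaust_2[of i] by (auto simp: orient_def algebra_simps)
  then have "d $ i = u * a $ i + v * b $ i + w * c $ i" for i
    using assms(1) by (simp add: u_def v_def w_def field_simps)
  then have "d = u *\<^sub>R a + v *\<^sub>R b + w *\<^sub>R c"
    by (simp add: vec_eq_iff)
  moreover have "u \<ge> 0" "v \<ge> 0" "w \<ge> 0"
    using assms by (simp_all add: u_def v_def w_def)
  ultimately show ?thesis using sum by (auto simp: convex_hull_3)
qed

lemma strict_total_order_enumeration: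
  fixes less :: "'a \<Rightarrow> 'a \<Rightarrow> bool"
  assumes "finite V"
    and irrefl: "\<And>x. x \<in> V \<Longrightarrow> \<not> less x x"
    and trans: "\<And>x y z. x \<in> V \<Longrightarrow> y \<in> V \<Longrightarrow> z \<in> V \<Longrightarrow> less x y \<Longrightarrow> less y z \<Longrightarrow> less x z"
    and total: "\<And>x y. x \<in> V \<Longrightarrow> y \<in> V \<Longrightarrow> x \<noteq> y \<Longrightarrow> less x y \<or> less y x"
  obtains f where "bij_betw f {..<card V} V"
    and "\<And>i j. i < j \<Longrightarrow> j < card V \<Longrightarrow> less (f i) (f j)"
proof -
  \<comment> \<open>The rank of \<open>x\<close> counts its predecessors; it is strictly monotone,
    hence a bijection onto the indices, and its inverse is the enumeration.\<close>
  define r where "r x = card {y \<in> V. less y x}" for x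
  have mono: "r x < r y" if "x \<in> V" "y \<in> V" "less x y" for x y
    unfolding r_def
  proof (rule psubset_card_mono)
    have "x \<in> {z \<in> V. less z y}" "x \<notin> {z \<in> V. less z x}" using that irrefl by auto
    moreover have "{z \<in> V. less z x} \<subseteq> {z \<in> V. less z y}" using that trans by blast
    ultimately show "{z \<in> V. less z x} \<subset> {z \<in> V. less z y}" by blast
  qed (use \<open>finite V\<close> in simp)
  have inj: "inj_on r V"
    by (rule inj_onI) (metis mono total less_irrefl)
  have "r x < card V" if "x \<in> V" for x
    unfolding r_def using that irrefl by (intro psubset_card_mono \<open>finite V\<close>) blast
  then have "r ` V \<subseteq> {..<card V}" by auto
  then have "r ` V = {..<card V}"
    by (simp add: card_image card_subset_eq inj)
  then have bij: "bij_betw r V {..<card V}" using inj by (simp add: bij_betw_def)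
  define f where "f = the_inv_into V r"
  have f: "bij_betw f {..<card V} V" unfolding f_def by (rule bij_betw_the_inv_into[OF bij])
  have rf: "r (f i) = i" if "i < card V" for i
    using f_the_inv_into_f_bij_betw[OF bij, of i] that by (simp add: f_def)
  show ?thesis
  proof
    fix i j assume "i < j" "j < card V"
    moreover from this have V: "f i \<in> V" "f j \<in> V" using f by (auto simp: bij_betw_def)
    ultimately have "r (f i) < r (f j)" using rf by simp
    then have "\<not> less (f j) (f i)" "f i \<noteq> f j" using mono[OF V(2,1)] by auto
    then show "less (f i) (f j)" using total V by blast
  qed (fact f)
qed

text \<open>Sorts the vertices by angle around one fixed vertex. Convex position makes this relation
  transitive and makes every increasing triple turn counterclockwise.\<close>

lemma convex_position_enumeration:
  fixes p :: "'a \<Rightarrow> real^2"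
  assumes "finite V" and inj: "inj_on p V"
    and gp: "general_position (p ` V)" and cp: "convex_position (p ` V)"
  obtains f where "bij_betw f {..<card V} V"
    and "\<And>i j k. i < j \<Longrightarrow> j < k \<Longrightarrow> k < card V \<Longrightarrow> orient (p (f i)) (p (f j)) (p (f k)) > 0"
proof (cases "V = {}")
  case True
  then show ?thesis using that[of undefined] by (simp add: bij_betw_def)
next
  case False
  then obtain o' where o: "o' \<in> V" by blast
  \<comment> \<open>The base vertex \<open>o'\<close> comes first; the others follow
    counterclockwise as seen from \<open>o'\<close>.\<close>
  define less where "less x y \<longleftrightarrow> y \<noteq> o' \<and> (x = o' \<or> orient (p o') (p x) (p y) > 0)" for x y
  have nz: "orient (p x) (p y) (p z) \<noteq> 0"
    if "x \<in> V" "y \<in> V" "z \<in> V" "x \<noteq> y" "y \<noteq> z" "x \<noteq> z" for x y z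
    using gp that inj_onD[OF inj] orient_eq_0_imp_collinear
    unfolding general_position_def by (metis imageI)
  have no_triangle: False
    if "w \<in> V" "x \<in> V" "y \<in> V" "z \<in> V" "w \<noteq> x" "w \<noteq> y" "w \<noteq> z"
      "orient (p x) (p y) (p z) > 0" "orient (p w) (p y) (p z) \<ge> 0"
      "orient (p x) (p w) (p z) \<ge> 0" "orient (p x) (p y) (p w) \<ge> 0" for w x y z
  proof -
    have "p w \<in> convex hull {p x, p y, p z}" using that(8-11) by (rule in_triangleI)
    moreover have "{p x, p y, p z} \<subseteq> p ` V - {p w}"
      using that(1-7) inj_onD[OF inj] by blast
    ultimately show False
      using cp \<open>w \<in> V\<close> hull_mono unfolding convex_position_def by blast
  qed
  have sum4: "orient b c d = orient a b c + orient a c d - orient a b d" for a b c d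
    by (simp add: orient_def algebra_simps)
  \<comment> \<open>A failure of transitivity means that the directions to \<open>x\<close>,
    \<open>y\<close>, \<open>z\<close> wind around \<open>o'\<close>, which puts \<open>o'\<close>
    into the triangle of these three points.\<close>
  have trans: "less x z" if V: "x \<in> V" "y \<in> V" "z \<in> V" and xy: "less x y" and yz: "less y z" for x y z
  proof (rule ccontr)
    assume nless: "\<not> less x z"
    then have ne: "x \<noteq> o'" "y \<noteq> o'" "z \<noteq> o'" using xy yz by (auto simp: less_def)
    have 1: "orient (p o') (p x) (p y) > 0" "orient (p o') (p y) (p z) > 0"
      "orient (p o') (p x) (p z) \<le> 0"
      using xy yz nless ne by (auto simp: less_def)
    then have "orient (p o') (p z) (p x) \<ge> 0" by (simp add: orient_swap[of _ "p z"])
    moreover have "orient (p x) (p o') (p z) = orient (p o') (p z) (p x)"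
      "orient (p x) (p y) (p o') = orient (p o') (p x) (p y)"
      by (metis orient_rotate)+
    moreover have "orient (p x) (p y) (p z) > 0"
      using 1 sum4[of "p x" "p y" "p z" "p o'"] by linarith
    ultimately show False
      using no_triangle[of o' x y z] V o ne 1 by auto
  qed
  obtain f where f: "bij_betw f {..<card V} V"
    and mono: "\<And>i j. i < j \<Longrightarrow> j < card V \<Longrightarrow> less (f i) (f j)"
  proof (rule strict_total_order_enumeration[of V less])
    show "\<not> less x x" for x by (simp add: less_def)
    show "less x z" if "x \<in> V" "y \<in> V" "z \<in> V" "less x y" "less y z" for x y z
      using that by (rule trans)
    show "less x y \<or> less y x" if "x \<in> V" "y \<in> V" "x \<noteq> y" for x y
      using that nz[of o' x y] o orient_swap[of "p o'" "p y" "p x"]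
      by (cases "x = o'"; cases "y = o'") (auto simp: less_def)
  qed (use \<open>finite V\<close> in auto)
  show ?thesis
  proof
    fix i j k assume ijk: "i < j" "j < k" "k < card V"
    define x y z where "x = f i" and "y = f j" and "z = f k"
    have V: "x \<in> V" "y \<in> V" "z \<in> V"
      using f ijk by (auto simp: bij_betw_def x_def y_def z_def)
    have l: "less x y" "less y z" "less x z" using mono ijk by (auto simp: x_def y_def z_def)
    then have ne: "y \<noteq> o'" "z \<noteq> o'" "x \<noteq> y" "y \<noteq> z" "x \<noteq> z" by (auto simp: less_def)
    have "orient (p x) (p y) (p z) > 0"
    proof (cases "x = o'")
      case True
      then show ?thesis using l ne by (auto simp: less_def)
    next
      case False
      then have pos: "orient (p o') (p x) (p y) > 0" "orient (p o') (p y) (p z) > 0"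
        "orient (p o') (p x) (p z) > 0" using l by (auto simp: less_def)
      \<comment> \<open>Otherwise \<open>y\<close>, whose direction from \<open>o'\<close> lies
        between those of \<open>x\<close> and \<open>z\<close>, would be in the triangle of
        \<open>o'\<close>, \<open>x\<close>, \<open>z\<close>.\<close>
      show ?thesis
      proof (rule ccontr)
        assume "\<not> ?thesis"
        moreover have "orient (p y) (p x) (p z) = - orient (p x) (p y) (p z)"
          by (simp add: orient_def algebra_simps)
        ultimately have "orient (p y) (p x) (p z) \<ge> 0" by simp
        then show False using no_triangle[of y o' x z] V o ne pos False by auto
      qed
    qed
    then show "orient (p (f i)) (p (f j)) (p (f k)) > 0" by (simp add: x_def y_def z_def)
  qed (fact f)
qed

section \<open>Crossing segments\<close>

text \<open>The line through \<open>a\<close> and \<open>b\<close> separates: \<open>c\<close> and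
  \<open>d\<close> lie weakly to its left and not both on it, so inner points of their segment lie
  strictly to its left.\<close>

lemma open_segments_disjoint:
  assumes "orient a b c \<ge> 0" "orient a b d \<ge> 0" "orient a b c \<noteq> 0 \<or> orient a b d \<noteq> 0"
  shows "open_segment a b \<inter> open_segment c d = {}"
proof -
  have False if "x \<in> open_segment a b" "x \<in> open_segment c d" for x
  proof -
    obtain s where s: "x = (1 - s) *\<^sub>R a + s *\<^sub>R b"
      using \<open>x \<in> open_segment a b\<close> by (auto simp: in_segment)
    obtain t where t: "x = (1 - t) *\<^sub>R c + t *\<^sub>R d" "0 < t" "t < 1"
      using \<open>x \<in> open_segment c d\<close> unfolding in_segment by blast
    have "orient a b x = 0" unfolding s by (simp add: orient_affine)
    moreover have "orient a b x > 0"
      unfolding t(1) orient_affine using assms t(2,3)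
      by (cases "orient a b c = 0") (auto intro: add_pos_nonneg add_nonneg_pos)
    ultimately show False by simp
  qed
  then show ?thesis by blast
qed

text \<open>The hypotheses say that \<open>a\<close>, \<open>c\<close>, \<open>b\<close>,
  \<open>d\<close> is a convex quadrilateral in counterclockwise order, so the two segments are its
  diagonals. Their common point is given explicitly by area ratios.\<close>

lemma open_segments_meet:
  assumes "orient a c b > 0" "orient c b d > 0" "orient b d a > 0" "orient d a c > 0"
  shows "open_segment a b \<inter> open_segment c d \<noteq> {}"
proof -
  let ?s = "orient d a c" and ?s' = "orient c b d" and ?t = "orient a c b" and ?t' = "orient b d a"
  \<comment> \<open>Twice the area of the quadrilateral; cutting along either diagonal gives the
    same total.\<close>
  define D where "D = ?s + ?s'"
  have D: "D = ?t + ?t'" "D > 0" using assms by (simp_all add: D_def orient_def algebra_simps)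
  have eq: "?s' * a $ i + ?s * b $ i = ?t' * c $ i + ?t * d $ i" for i
    using exhaust_2[of i] by (auto simp: orient_def algebra_simps)
  have "(1 - ?s / D) *\<^sub>R a + (?s / D) *\<^sub>R b = (1 - ?t / D) *\<^sub>R c + (?t / D) *\<^sub>R d"
  proof -
    have "1 - ?s / D = ?s' / D" using D(2) by (simp add: D_def field_simps)
    moreover have "1 - ?t / D = ?t' / D" using D by (simp add: field_simps)
    ultimately show ?thesis using eq by (simp add: vec_eq_iff flip: add_divide_distrib)
  qed
  moreover have "0 < ?s / D" "?s / D < 1" "0 < ?t / D" "?t / D < 1"
    using assms D by (auto simp: D_def)
  moreover have "a \<noteq> b" "c \<noteq> d" using assms by auto
  ultimately have "(1 - ?s / D) *\<^sub>R a + (?s / D) *\<^sub>R b \<in> open_segment a b"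
    "(1 - ?s / D) *\<^sub>R a + (?s / D) *\<^sub>R b \<in> open_segment c d"
    unfolding in_segment by blast+
  then show ?thesis by blast
qed

lemma crosses_commute: "crosses p e f \<longleftrightarrow> crosses p f e"
  by (auto simp: crosses_def)

lemma not_crosses_refl: "\<not> crosses p e e"
  by (simp add: crosses_def)

lemma crosses_pair:
  assumes "p a \<noteq> p b" "p c \<noteq> p d"
  shows "crosses p {a, b} {c, d} \<longleftrightarrow>
    {a, b} \<noteq> {c, d} \<and> open_segment (p a) (p b) \<inter> open_segment (p c) (p d) \<noteq> {}"
  using assms unfolding crosses_def edge_segment_def
  by (simp add: rel_interior_closed_segment flip: segment_convex_hull)

text \<open>The bridge from geometry to indices: interleaving chords are diagonals of a convex
  quadrilateral, while for other distinct chords the line through the first has the second weakly on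
  one side.\<close>

lemma crosses_iff_interleave:
  fixes p :: "'a \<Rightarrow> real^2"
  assumes pos: "\<And>i j k. i < j \<Longrightarrow> j < k \<Longrightarrow> k < n \<Longrightarrow> orient (p (f i)) (p (f j)) (p (f k)) > 0"
    and inj: "inj_on (p \<circ> f) {..<n}"
    and lt: "a < b" "b < n" "c < d" "d < n"
  shows "crosses p {f a, f b} {f c, f d} \<longleftrightarrow> interleave (a, b) (c, d)"
proof -
  define q where "q i = p (f i)" for i
  have pos: "orient (q i) (q j) (q k) > 0" if "i < j" "j < k" "k < n" for i j k
    using pos that by (simp add: q_def)
  have q_ne: "q i \<noteq> q j" if "i < j" "j < n" for i j
    using inj_onD[OF inj, of i j] that by (auto simp: q_def)
  have meet: "open_segment (q i) (q k) \<inter> open_segment (q j) (q l) \<noteq> {}"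
    if "i < j" "j < k" "k < l" "l < n" for i j k l
  proof (rule open_segments_meet)
    show "orient (q i) (q j) (q k) > 0" "orient (q j) (q k) (q l) > 0" using pos that by auto
    have "orient (q i) (q k) (q l) > 0" "orient (q i) (q j) (q l) > 0" using pos that by auto
    then show "orient (q k) (q l) (q i) > 0" "orient (q l) (q i) (q j) > 0"
      by (metis orient_rotate)+
  qed
  \<comment> \<open>Indices outside the range from \<open>a\<close> to \<open>b\<close> give points
    weakly left of the chord, those within it points weakly right; \<open>inside\<close> expresses
    the latter by reversing the chord.\<close>
  have outside: "orient (q a) (q b) (q k) \<ge> 0" if k: "k \<le> a \<or> b \<le> k" "k < n" for k
  proof -
    consider "k < a" | "k = a \<or> k = b" | "b < k" using k by linarith
    then show ?thesis
    proof cases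
      case 1
      then show ?thesis using pos[of k a b] lt by (metis orient_rotate less_imp_le)
    qed (use pos[of a b k] lt k in \<open>auto simp: less_imp_le\<close>)
  qed
  have inside: "orient (q b) (q a) (q k) \<ge> 0" if k: "a \<le> k" "k \<le> b" for k
  proof -
    consider "k = a \<or> k = b" | "a < k" "k < b" using k by linarith
    then show ?thesis
    proof cases
      case 2
      then show ?thesis using pos[of a k b] lt by (metis orient_rotate less_imp_le)
    qed auto
  qed
  have nz: "orient (q a) (q b) (q k) \<noteq> 0" if k: "k \<noteq> a" "k \<noteq> b" "k < n" for k
  proof -
    consider "k < a" | "a < k" "k < b" | "b < k" using k by linarith
    then show ?thesis
      using pos[of k a b] pos[of a k b] pos[of a b k] lt k
        orient_rotate[of "q k" "q a" "q b"] orient_swap[of "q a" "q k" "q b"]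
      by cases auto
  qed
  have disj: "open_segment (q a) (q b) \<inter> open_segment (q c) (q d) = {}"
    if ni: "\<not> interleave (a, b) (c, d)" and ne: "(a, b) \<noteq> (c, d)"
  proof -
    \<comment> \<open>Distinct chords share at most one endpoint, so \<open>c\<close> or
      \<open>d\<close> is off the line through \<open>q a\<close> and \<open>q b\<close>.\<close>
    have nz': "orient (q a) (q b) (q c) \<noteq> 0 \<or> orient (q a) (q b) (q d) \<noteq> 0"
      using nz[of c] nz[of d] ne lt by (cases "c = a \<or> c = b"; cases "d = a \<or> d = b") auto
    have rev: "orient (q b) (q a) x = - orient (q a) (q b) x" for x
      by (simp add: orient_def algebra_simps)
    have "(c \<le> a \<or> b \<le> c) \<and> (d \<le> a \<or> b \<le> d) \<or> (a \<le> c \<and> c \<le> b) \<and> (a \<le> d \<and> d \<le> b)"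
      using ni lt by auto
    then show ?thesis
    proof
      assume "(c \<le> a \<or> b \<le> c) \<and> (d \<le> a \<or> b \<le> d)"
      then show ?thesis using outside nz' lt by (intro open_segments_disjoint) auto
    next
      assume "(a \<le> c \<and> c \<le> b) \<and> (a \<le> d \<and> d \<le> b)"
      then have "open_segment (q b) (q a) \<inter> open_segment (q c) (q d) = {}"
        using inside nz' rev by (intro open_segments_disjoint) auto
      then show ?thesis by (simp add: open_segment_commute)
    qed
  qed
  have edge_eq: "{f a, f b} = {f c, f d} \<longleftrightarrow> (a, b) = (c, d)"
  proof
    assume "{f a, f b} = {f c, f d}"
    then have "{q a, q b} = {q c, q d}" unfolding q_def by (metis image_insert image_empty)
    then have "(a = c \<and> b = d) \<or> (a = d \<and> b = c)"
      using inj_onD[OF inj] lt by (auto simp: q_def doubleton_eq_iff)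
    then show "(a, b) = (c, d)" using lt by auto
  qed auto
  have "crosses p {f a, f b} {f c, f d} \<longleftrightarrow>
      (a, b) \<noteq> (c, d) \<and> open_segment (q a) (q b) \<inter> open_segment (q c) (q d) \<noteq> {}"
    using crosses_pair[of p "f a" "f b" "f c" "f d"] q_ne[OF lt(1,2)] q_ne[OF lt(3,4)] edge_eq
    by (simp add: q_def)
  also have "\<dots> \<longleftrightarrow> interleave (a, b) (c, d)"
    using disj meet[of a c b d] meet[of c a d b] lt not_interleave_refl[of "(a, b)"]
    by (auto simp: Int_commute)
  finally show ?thesis .
qed

section \<open>Counting edges of saturated drawings\<close>

lemma precolored_theta2_drawing_insertI:
  assumes "precolored_theta2_drawing V E p \<phi>" "i \<in> {1, 2}"
    and "u \<in> V" "v \<in> V" "u \<noteq> v" "{u, v} \<notin> E"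
    and nc: "\<And>e. e \<in> E \<Longrightarrow> \<phi> e = i \<Longrightarrow> \<not> crosses p {u, v} e"
  shows "precolored_theta2_drawing V (insert {u, v} E) p (\<phi>({u, v} := i))"
proof -
  have "straight_line_drawing V (insert {u, v} E) p"
    using assms by (auto simp: precolored_theta2_drawing_def straight_line_drawing_def simple_graph_def)
  moreover have "\<not> crosses p e {u, v}" if "e \<in> E" "\<phi> e = i" for e
    using nc[OF that] by (simp add: crosses_commute)
  ultimately show ?thesis
    using assms not_crosses_refl[of p "{u, v}"]
    by (auto simp: precolored_theta2_drawing_def split: if_splits)
qed

text \<open>Reduces the uncolored claim to the precolored one: extending a fixed valid coloring by
  an edge would in particular give a larger drawing of the uncolored kind.\<close>

lemma saturated_imp_saturated_precolored:
  assumes "saturated_theta2_drawing V E p"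
  shows "\<exists>\<phi>. saturated_precolored_theta2_drawing V E p \<phi>"
  using assms
  unfolding saturated_theta2_drawing_def saturated_precolored_theta2_drawing_def theta2_drawing_def
  by blast

lemma card_saturated_precolored_convex:
  fixes V :: "'a set" and E :: "'a set set" and p :: "'a \<Rightarrow> real^2"
  assumes "card V \<ge> 3" and sat: "saturated_precolored_theta2_drawing V E p \<phi>"
    and cp: "convex_position (p ` V)"
  shows "card E = 3 * card V - 6"
proof -
  define n where "n = card V"
  have n: "n \<ge> 3" using assms by (simp add: n_def)
  have dr: "precolored_theta2_drawing V E p \<phi>"
    using sat by (simp add: saturated_precolored_theta2_drawing_def)
  then have sg: "finite V" "\<And>e. e \<in> E \<Longrightarrow> e \<subseteq> V \<and> card e = 2"
    and inj: "inj_on p V" and gp: "general_position (p ` V)"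
    and col: "\<phi> ` E \<subseteq> {1, 2}"
    and nc: "\<And>e f. e \<in> E \<Longrightarrow> f \<in> E \<Longrightarrow> \<phi> e = \<phi> f \<Longrightarrow> \<not> crosses p e f"
    by (auto simp: precolored_theta2_drawing_def straight_line_drawing_def simple_graph_def)
  obtain f where f: "bij_betw f {..<n} V"
    and pos: "\<And>i j k. i < j \<Longrightarrow> j < k \<Longrightarrow> k < n \<Longrightarrow> orient (p (f i)) (p (f j)) (p (f k)) > 0"
    using convex_position_enumeration[OF sg(1) inj gp cp] unfolding n_def by blast
  have injf: "inj_on f {..<n}" and fV: "f ` {..<n} = V" using f by (auto simp: bij_betw_def)
  have injpf: "inj_on (p \<circ> f) {..<n}" using inj injf fV by (simp add: comp_inj_on)
  \<comment> \<open>Edges are encoded by increasing index pairs; \<open>g\<close> translates back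
    and is injective on \<open>P\<close>, so counting can be done with pairs.\<close>
  define P where "P = {(x, y). x < y \<and> y < n}"
  define g where "g = (\<lambda>(x, y). {f x, f y})"
  have cross: "crosses p (g s) (g t) \<longleftrightarrow> interleave s t" if "s \<in> P" "t \<in> P" for s t
    using that crosses_iff_interleave[where p = p and f = f and n = n, OF pos injpf]
    by (cases s; cases t) (auto simp: P_def g_def)
  have injg: "inj_on g P"
  proof (rule inj_onI)
    fix s t assume "s \<in> P" "t \<in> P" "g s = g t"
    then show "s = t"
      using inj_onD[OF injf] by (cases s; cases t) (fastforce simp: P_def g_def doubleton_eq_iff)
  qed
  have Eg: "E \<subseteq> g ` P"
  proof
    fix e assume "e \<in> E"
    then obtain u v where uv: "e = {u, v}" "u \<noteq> v" "u \<in> V" "v \<in> V"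
      using sg(2)[of e] by (auto simp: card_2_iff)
    then obtain i j where ij: "u = f i" "v = f j" "i < n" "j < n" using fV by blast
    then have "e = g (i, j)" "e = g (j, i)" "i \<noteq> j" using uv by (auto simp: g_def)
    then show "e \<in> g ` P" using ij by (cases "i < j") (auto simp: P_def)
  qed
  \<comment> \<open>Saturation in usable form: each missing edge is blocked in each color by an edge
    of that color.\<close>
  have ex: "\<exists>e\<in>E. \<phi> e = i \<and> crosses p (g t) e" if t: "t \<in> P" "g t \<notin> E" and i: "i \<in> {1, 2}" for t i
  proof (rule ccontr)
    assume *: "\<not> ?thesis"
    obtain x y where xy: "t = (x, y)" "x < y" "y < n" using t by (auto simp: P_def)
    then have V: "f x \<in> V" "f y \<in> V" "f x \<noteq> f y" using fV inj_onD[OF injf, of x y] by auto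
    then have "precolored_theta2_drawing V (insert {f x, f y} E) p (\<phi>({f x, f y} := i))"
      using * t xy by (intro precolored_theta2_drawing_insertI[OF dr i]) (auto simp: g_def)
    then show False
      using sat V t xy i unfolding saturated_precolored_theta2_drawing_def by (auto simp: g_def)
  qed
  \<comment> \<open>The sides of the polygon. They interleave with nothing: no index lies strictly
    between consecutive ones, and none outside the range from \<open>0\<close> to
    \<open>n - 1\<close>.\<close>
  define H where "H = insert (0, n - 1) ((\<lambda>i. (i, Suc i)) ` {..<n - 1})"
  have HP: "H \<subseteq> P" using n by (auto simp: H_def P_def)
  have Hni: "\<not> interleave h t" if "h \<in> H" "t \<in> P" for h t
    using that by (cases t) (auto simp: H_def P_def)
  have HE: "g h \<in> E" if "h \<in> H" for h
  proof (rule ccontr)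
    assume "g h \<notin> E"
    then obtain e where "e \<in> E" "crosses p (g h) e"
      using ex[of h 1] \<open>h \<in> H\<close> HP by auto
    then obtain t where "t \<in> P" "crosses p (g h) (g t)" using Eg by blast
    then show False using cross Hni \<open>h \<in> H\<close> HP by blast
  qed
  have "card H = n"
  proof -
    have "card ((\<lambda>i. (i, Suc i)) ` {..<n - 1}) = n - 1"
      by (subst card_image) (auto simp: inj_on_def)
    \<comment> \<open>For \<open>n = 2\<close> the closing side would coincide with the pair
      \<open>(0, 1)\<close>.\<close>
    moreover have "(0, n - 1) \<notin> (\<lambda>i. (i, Suc i)) ` {..<n - 1}" using n by auto
    ultimately show ?thesis using n by (simp add: H_def)
  qed
  \<comment> \<open>One color class together with all sides, whatever the color of the
    sides.\<close>
  define S where "S i = {t \<in> P. g t \<in> E \<and> \<phi> (g t) = i} \<union> H" for i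
  have cardS: "card (S i) = 2 * (n - 1 - 0) - 1" if i: "i \<in> {1, 2}" for i
  proof (rule card_triangulated_interval)
    show "0 < n - 1" using n by simp
    have SP: "S i \<subseteq> P" using HP by (auto simp: S_def)
    show "S i \<subseteq> {(x, y). 0 \<le> x \<and> x < y \<and> y \<le> n - 1}" using SP by (auto simp: P_def)
    show "\<forall>s\<in>S i. \<forall>t\<in>S i. \<not> interleave s t"
    proof (intro ballI)
      fix s t assume st: "s \<in> S i" "t \<in> S i"
      then have P: "s \<in> P" "t \<in> P" using SP by auto
      show "\<not> interleave s t"
      proof (cases "s \<in> H \<or> t \<in> H")
        case True
        then show ?thesis using Hni P interleave_commute by blast
      next
        case False
        then show ?thesis using st nc[of "g s" "g t"] cross[OF P] by (auto simp: S_def)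
      qed
    qed
    show "(0, n - 1) \<in> S i" "\<forall>j. 0 \<le> j \<and> j < n - 1 \<longrightarrow> (j, Suc j) \<in> S i"
      by (auto simp: S_def H_def)
    fix x x' y y' assume h: "x < x'" "x' < y" "y < y'" "y' \<le> n - 1"
    let ?s = "(x, y)" and ?t = "(x', y')"
    have P: "?s \<in> P" "?t \<in> P" using h n by (auto simp: P_def)
    have il: "interleave ?s ?t" using h by simp
    show "\<exists>r\<in>S i. interleave ?s r \<or> interleave ?t r"
    proof (rule ccontr)
      assume neg: "\<not> ?thesis"
      \<comment> \<open>A missing diagonal would be blocked by an edge of color \<open>i\<close>,
        which lies in \<open>S i\<close>, against \<open>neg\<close>. A diagonal in
        \<open>S i\<close> itself would interleave with the other diagonal, again against
        \<open>neg\<close>.\<close>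
      have other: "g r \<in> E \<and> \<phi> (g r) \<noteq> i" if r: "r \<in> {?s, ?t}" for r
      proof -
        have rP: "r \<in> P" using r P by auto
        have "g r \<in> E"
        proof (rule ccontr)
          assume "g r \<notin> E"
          then obtain e where e: "e \<in> E" "\<phi> e = i" "crosses p (g r) e" using ex[OF rP _ i] by blast
          then obtain t where t: "t \<in> P" "e = g t" using Eg by blast
          then have "t \<in> S i" "interleave r t" using e cross[OF rP] by (auto simp: S_def)
          then show False using neg r by auto
        qed
        moreover have "r \<notin> S i"
          using neg il interleave_commute[of ?s ?t] r by auto
        ultimately show ?thesis using rP by (auto simp: S_def)
      qed
      have "\<phi> (g ?s) \<in> {1, 2} - {i}" "\<phi> (g ?t) \<in> {1, 2} - {i}" using other[of ?s] other[of ?t] col by auto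
      then have "\<phi> (g ?s) = \<phi> (g ?t)" using i by auto
      then show False using nc[of "g ?s" "g ?t"] other[of ?s] other[of ?t] cross[OF P] il by auto
    qed
  qed
  have "P \<subseteq> {..<n} \<times> {..<n}" by (auto simp: P_def)
  then have finP: "finite P" using finite_subset by blast
  then have finS: "finite (S i)" for i using HP finite_subset by (auto simp: S_def)
  \<comment> \<open>An edge has only one color, so the two sets can share nothing but sides.\<close>
  have inter: "S 1 \<inter> S 2 = H" by (auto simp: S_def)
  have union: "S 1 \<union> S 2 = {t \<in> P. g t \<in> E}"
    using col HE HP by (auto simp: S_def)
  have "card E = card (g ` {t \<in> P. g t \<in> E})"
    using Eg by (intro arg_cong[where f = card]) auto
  also have "\<dots> = card (S 1 \<union> S 2)"
    unfolding union by (intro card_image inj_on_subset[OF injg]) auto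
  finally have "card E + n = card (S 1) + card (S 2)"
    using card_Un_Int[OF finS finS, of 1 2] inter \<open>card H = n\<close> by simp
  then show ?thesis using cardS[of 1] cardS[of 2] n by (simp add: n_def)
qed

theorem corollary2p6:
  fixes V :: "'a set" and E :: "'a set set" and p :: "'a \<Rightarrow> real^2" and n :: nat
  assumes "n \<ge> 3" and "simple_graph V E" and "card V = n"
  shows "(saturated_theta2_drawing V E p \<and> convex_position (p ` V) \<longrightarrow> card E = 3 * n - 6) \<and>
         (\<forall>\<phi>. saturated_precolored_theta2_drawing V E p \<phi> \<and> convex_position (p ` V)
              \<longrightarrow> card E = 3 * n - 6)"
  using assms card_saturated_precolored_convex saturated_imp_saturated_precolored by blast

end
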